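(* Let $m,n,r$ be positive integers with $rm\le n$, let $q=2^m$, let $G(x)\in\mathbb{F}_q[x]$ have degree $r$ and have only distinct roots (in its splitting field), and let $\mathcal{L}=\{f_1(x),\dots,f_n(x)\}$ be a set of $n$ irreducible polynomials in $\mathbb{F}_q[x]$, all of even degree, with $\gcd(f_i(x),f_j(x))=1$ for all $i\ne j$ and $\gcd(f_i(x),G(x))=1$ for all $i$. Let $l=\max_{f(x)\in\mathcal{L}}\deg f(x)$. Then the minimum Hamming distance of the binary separable generalized Goppa code $\Gamma(\mathcal{L},G)$ satisfies $$d(\Gamma(\mathcal{L},G))\ \ge\ \frac{2r+2}{l}.$$
   Context: The binary generalized Goppa code is $$\Gamma(\mathcal{L},G)=\Bigl\{\mathbf{c}\in\mathbb{F}_2^n : \sum_{i=1}^n c_i\frac{f_i'(x)}{f_i(x)}= 0 \bmod G(x)\Bigr\},$$ where $f_i'$ is the formal derivative and $1/f_i(x)$ is the inverse of $f_i(x)$ in $\mathbb{F}_q[x]/(G(x))$. It is called separable when $G$ has only distinct roots. The minimum Hamming distance is the minimum number of nonzero entries over nonzero codewords (the bound is vacuous if the code is $\{\mathbf{0}\}$). *)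

theory Defs
  imports
    "HOL-Algebra.Algebraic_Closure_Type"
    "HOL-Analysis.Finite_Cartesian_Product"
    "HOL-Library.Extended_Real"
    "HOL-Library.Z2"
    "HOL-Number_Theory.Cong"
begin

text \<open>
  \<open>rsquarefree\<close> only bounds the multiplicities of roots in the coefficient field, hence the passage
  to the algebraic closure, which contains a splitting field of \<open>G\<close>.
\<close>
definition distinct_roots :: "'a :: field poly \<Rightarrow> bool" where
  "distinct_roots G \<longleftrightarrow> rsquarefree (map_poly to_ac G)"

text \<open>
  The inverse of \<open>f\<close> in the quotient ring modulo \<open>G\<close>, given by its reduced representative; it is
  unspecified if \<open>f\<close> is not coprime to \<open>G\<close>.
\<close>
definition poly_inverse_mod :: "'a :: field poly \<Rightarrow> 'a poly \<Rightarrow> 'a poly" where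
  "poly_inverse_mod G f = (THE h. h mod G = h \<and> [f * h = 1] (mod G))"

text \<open>
  The locators are given as a family indexed by the coordinate positions. The function \<open>of_bit\<close>
  is the embedding of the prime field when \<open>'a\<close> has characteristic 2.
\<close>
definition generalized_goppa_code ::
    "('n :: finite \<Rightarrow> 'a :: field poly) \<Rightarrow> 'a poly \<Rightarrow> (bit ^ 'n) set" where
  "generalized_goppa_code f G =
     {c. [(\<Sum>i\<in>UNIV. Polynomial.smult (of_bit (vec_nth c i))
             (pderiv (f i) * poly_inverse_mod G (f i))) = 0] (mod G)}"

definition hamming_weight :: "bit ^ ('n :: finite) \<Rightarrow> nat" where
  "hamming_weight c = card {i. vec_nth c i \<noteq> 0}"

text \<open>The infimum is \<open>\<infinity>\<close> for a code without nonzero codewords and a minimum otherwise.\<close>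
definition minimum_distance :: "(bit ^ ('n :: finite)) set \<Rightarrow> enat" where
  "minimum_distance C = (INF c\<in>C - {0}. enat (hamming_weight c))"

end

theory Submission
  imports
    Defs
    "HOL-Computational_Algebra.Squarefree"
    "HOL-Computational_Algebra.Polynomial_Factorial"
    "HOL-Number_Theory.Residues"
begin

text \<open>
  For a nonzero codeword \<open>c\<close> let \<open>F\<close> be the product of the locators in the support of \<open>c\<close>. The code
  condition, multiplied by \<open>F\<close>, says that \<open>G\<close> divides the formal derivative of \<open>F\<close>. Over a perfect
  field of characteristic 2 this derivative is a square \<open>H\<^sup>2\<close>, so the squarefree \<open>G\<close> divides \<open>H\<close>
  and \<open>G\<^sup>2\<close> divides the derivative. The derivative is nonzero, since otherwise \<open>F\<close> itself would be
  a square, contrary to the locators being pairwise coprime and irreducible. As a square the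
  derivative has even degree; since \<open>deg F\<close> is even as well, its degree is at most \<open>deg F - 2\<close>. Hence \<open>2 r + 2 \<le> deg F \<le> l \<cdot> wt(c)\<close>.
\<close>

section \<open>Bezout identities and squarefree divisors of squares in
  \<open>'a poly\<close>\<close>

lemma poly_bezout:
  fixes a b :: "'a :: field poly"
  obtains d u v where "d = u * a + v * b" "d dvd a" "d dvd b"
proof -
  have "\<exists>d u v. d = u * a + v * b \<and> d dvd a \<and> d dvd b"
  proof (induction "euclidean_size b" arbitrary: a b rule: less_induct)
    case less
    show ?case
    proof (cases "b = 0")
      case True
      then have "a = 1 * a + 0 * b \<and> a dvd a \<and> a dvd b" by simp
      then show ?thesis by blast
    next
      case False
      then have "euclidean_size (a mod b) < euclidean_size b"
        by (rule mod_size_less)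
      from less[OF this, of b] obtain d u v
        where d: "d = u * b + v * (a mod b)" "d dvd b" "d dvd a mod b" by blast
      have "d dvd a" using d(2,3) by (simp add: dvd_mod_iff)
      moreover have "d = v * a + (u - v * (a div b)) * b"
        using d(1) by (simp add: minus_div_mult_eq_mod[symmetric] algebra_simps)
      ultimately show ?thesis using d(2) by blast
    qed
  qed
  then show ?thesis using that by blast
qed

lemma poly_coprime_bezout:
  fixes a b :: "'a :: field poly"
  assumes "coprime a b"
  obtains u v where "u * a + v * b = 1"
proof -
  obtain d u v where d: "d = u * a + v * b" "d dvd a" "d dvd b" by (rule poly_bezout)
  then have "d dvd 1" using assms by (meson coprime_common_divisor)
  then obtain e where "1 = d * e" by (rule dvdE)
  then have "(e * u) * a + (e * v) * b = 1" using d(1) by (simp add: algebra_simps)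
  then show ?thesis by (rule that)
qed

lemma poly_coprime_dvd_multD:
  fixes a b c :: "'a :: field poly"
  assumes "coprime a b" "a dvd b * c"
  shows "a dvd c"
proof -
  obtain u v where uv: "u * a + v * b = 1" using assms(1) by (rule poly_coprime_bezout)
  have "a dvd (u * c) * a + v * (b * c)" by (intro dvd_add dvd_mult[OF assms(2)] dvd_triv_right)
  also have "(u * c) * a + v * (b * c) = (u * a + v * b) * c" by (simp add: algebra_simps)
  finally show ?thesis unfolding uv by simp
qed

text \<open>Split off a greatest common divisor: \<open>G = d * e\<close>, \<open>H = d * k\<close>.
  Squarefreeness makes \<open>e\<close> coprime to \<open>d\<close>, so \<open>e\<close> divides
  \<open>k ^ 2\<close>; being coprime to \<open>k\<close> as well, it divides
  \<open>k\<close>.\<close>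

lemma squarefree_poly_dvd_square:
  fixes G H :: "'a :: field poly"
  assumes "squarefree G" "G dvd H ^ 2"
  shows "G dvd H"
proof -
  obtain d u v where d: "d = u * G + v * H" "d dvd G" "d dvd H" by (rule poly_bezout)
  obtain e where e: "G = d * e" using d(2) by (rule dvdE)
  obtain k where k: "H = d * k" using d(3) by (rule dvdE)
  have "d \<noteq> 0" using assms(1) e by auto
  have "coprime e d"
  proof (rule coprimeI)
    fix p assume "p dvd e" "p dvd d"
    then have "p ^ 2 dvd G" unfolding e power2_eq_square by (metis mult.commute mult_dvd_mono)
    then show "p dvd 1" by (rule squarefreeD[OF assms(1)])
  qed
  moreover have "e dvd d * k ^ 2"
  proof -
    have "d * e dvd d * (d * k ^ 2)"
      using assms(2) unfolding e k by (simp add: power2_eq_square algebra_simps)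
    then show ?thesis using \<open>d \<noteq> 0\<close> by simp
  qed
  ultimately have "e dvd k * k" unfolding power2_eq_square by (rule poly_coprime_dvd_multD)
  \<comment> \<open>Cancelling \<open>d\<close> in its own Bezout representation yields one of 1 by
    the cofactors.\<close>
  have "d * 1 = d * (u * e + v * k)" using d(1) unfolding e k by (simp add: algebra_simps)
  then have "u * e + v * k = 1" using \<open>d \<noteq> 0\<close> by (metis mult_cancel_left)
  then have "coprime e k" by (metis coprimeI dvd_add dvd_mult)
  then have "e dvd k" using \<open>e dvd k * k\<close> by (rule poly_coprime_dvd_multD)
  then show ?thesis unfolding e k by simp
qed

section \<open>Distinct roots and inverses modulo \<open>G\<close>\<close>

lemma map_poly_to_ac_mult:
  "map_poly to_ac (p * q) = map_poly to_ac p * map_poly to_ac q"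
  by (rule poly_eqI) (simp add: coeff_map_poly coeff_mult to_ac_sum)

text \<open>If \<open>x ^ 2\<close> divides \<open>G\<close> and \<open>x\<close> is not constant,
  then a root of \<open>x\<close> in the algebraic closure is a multiple root of \<open>G\<close>.
  Passing to the closure preserves the degree of \<open>x\<close>, so \<open>x\<close> must be a
  nonzero constant.\<close>

lemma distinct_roots_imp_squarefree:
  fixes G :: "'a :: field poly"
  assumes "distinct_roots G"
  shows "squarefree G"
proof (rule squarefreeI)
  fix x assume x: "x ^ 2 dvd G"
  let ?g = "map_poly to_ac G" and ?x = "map_poly to_ac x"
  have g: "?g \<noteq> 0" "\<And>a. order a ?g \<le> 1"
    using assms unfolding distinct_roots_def rsquarefree_def by (blast, metis le_refl zero_le_one)
  have dvd: "?x ^ 2 dvd ?g"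
    using x by (auto simp: dvd_def map_poly_to_ac_mult power2_eq_square)
  have "x \<noteq> 0" using x g(1) by auto
  have "degree ?x = 0"
  proof (rule ccontr)
    assume "degree ?x \<noteq> 0"
    then obtain a where "poly ?x a = 0" using alg_closed_imp_poly_has_root[of ?x] by auto
    then have "[:-a, 1:] ^ 2 dvd ?x ^ 2" by (simp add: poly_eq_0_iff_dvd dvd_power_same)
    then have "[:-a, 1:] ^ 2 dvd ?g" using dvd by (rule dvd_trans)
    then have "2 \<le> order a ?g" using g(1) by (simp only: order_divides) simp
    then show False using g(2)[of a] by simp
  qed
  then have "degree x = 0" by (simp add: degree_map_poly)
  then show "x dvd 1" using \<open>x \<noteq> 0\<close> by (simp add: is_unit_iff_degree)
qed

text \<open>The description operator needs a unique witness. A Bezout coefficient \<open>u\<close>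
  of \<open>f\<close>, reduced modulo \<open>G\<close>, is one; any other inverse \<open>h\<close>
  is congruent to it, since \<open>u * f * h\<close> is congruent to both \<open>u\<close> and
  \<open>h\<close>.\<close>

lemma poly_inverse_mod_cong:
  fixes f G :: "'a :: field poly"
  assumes "coprime f G"
  shows "[f * poly_inverse_mod G f = 1] (mod G)"
proof -
  obtain u v where uv: "u * f + v * G = 1" using assms by (rule poly_coprime_bezout)
  have *: "f * u - 1 = - v * G" using uv by (simp add: algebra_simps)
  have fu: "[f * u = 1] (mod G)" unfolding cong_iff_dvd_diff * by simp
  have "\<exists>!h. h mod G = h \<and> [f * h = 1] (mod G)"
  proof (rule ex1I)
    have "[f * (u mod G) = f * u] (mod G)" by (intro cong_scalar_left) simp
    then show "(u mod G) mod G = u mod G \<and> [f * (u mod G) = 1] (mod G)"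
      using fu by (auto intro: cong_trans)
  next
    fix h assume h: "h mod G = h \<and> [f * h = 1] (mod G)"
    have "[u * (f * h) = u * 1] (mod G)" using h by (intro cong_scalar_left) simp
    moreover have "[(f * u) * h = 1 * h] (mod G)" using fu by (rule cong_scalar_right)
    ultimately have "[h = u] (mod G)"
      by (metis cong_sym cong_trans mult.assoc mult.commute mult_1)
    then show "h = u mod G" using h by (simp add: cong_def)
  qed
  from theI'[OF this] show ?thesis unfolding poly_inverse_mod_def by simp
qed

section \<open>Squares and formal derivatives in characteristic 2\<close>

text \<open>In characteristic 2 squaring is additive, so the square root can be taken coefficientwise.\<close>
lemma poly_is_square_char_2:
  fixes P :: "'a :: comm_ring_prime_char poly"
  assumes char: "CHAR('a) = 2"
    and perfect: "\<And>x :: 'a. \<exists>y. y ^ 2 = x"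
    and odd: "\<And>i. odd i \<Longrightarrow> coeff P i = 0"
  obtains H where "P = H ^ 2"
proof -
  obtain s where s: "\<And>x :: 'a. s x ^ 2 = x" using perfect by metis
  let ?I = "{i. i \<le> degree P \<and> even i}"
  \<comment> \<open>For even \<open>i\<close> the square of \<open>monom (s a) (i div 2)\<close> is
    \<open>monom a i\<close>; the odd coefficients vanish by assumption.\<close>
  define H where "H = (\<Sum>i\<in>?I. monom (s (coeff P i)) (i div 2))"
  have "H ^ CHAR('a poly) = (\<Sum>i\<in>?I. monom (s (coeff P i)) (i div 2) ^ CHAR('a poly))"
    unfolding H_def by (rule freshmans_dream_sum) (simp_all add: char)
  then have "H ^ 2 = (\<Sum>i\<in>?I. monom (s (coeff P i)) (i div 2) ^ 2)"
    by (simp add: char)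
  also have "\<dots> = (\<Sum>i\<in>?I. monom (coeff P i) i)"
    by (rule sum.cong) (simp_all add: monom_power s)
  also have "\<dots> = (\<Sum>i\<le>degree P. monom (coeff P i) i)"
    by (rule sum.mono_neutral_left) (auto simp: odd)
  also have "\<dots> = P" by (rule poly_as_sum_of_monoms)
  finally show ?thesis by (rule that[OF sym])
qed

lemma even_imp_of_nat_eq_0:
  assumes "CHAR('a :: semiring_1) = 2" "even n"
  shows "of_nat n = (0 :: 'a)"
  using assms by (simp add: of_nat_eq_0_iff_char_dvd)

lemma pderiv_is_square_char_2:
  fixes F :: "'a :: field_prime_char poly"
  assumes "CHAR('a) = 2" "\<And>x :: 'a. \<exists>y. y ^ 2 = x"
  obtains H where "pderiv F = H ^ 2"
proof (rule poly_is_square_char_2[OF assms])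
  fix i :: nat assume "odd i"
  then show "coeff (pderiv F) i = 0"
    \<comment> \<open>The coefficient carries the factor \<open>Suc i\<close>, which is even and
      hence zero in the field.\<close>
    unfolding coeff_pderiv by (subst even_imp_of_nat_eq_0[OF assms(1)]) auto
qed (rule that)

text \<open>Differentiation multiplies the coefficient at an odd index by a nonzero scalar, so a
  vanishing derivative leaves only even exponents.\<close>

lemma pderiv_eq_0_imp_square_char_2:
  fixes F :: "'a :: field_prime_char poly"
  assumes "CHAR('a) = 2" "\<And>x :: 'a. \<exists>y. y ^ 2 = x" "pderiv F = 0"
  obtains K where "F = K ^ 2"
proof (rule poly_is_square_char_2[OF assms(1,2)])
  fix i :: nat assume i: "odd i"
  have "of_nat i * coeff F i = coeff (pderiv F) (i - 1)"
    using i by (cases i) (simp_all add: coeff_pderiv)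
  moreover have "of_nat i \<noteq> (0 :: 'a)"
    using i assms(1) by (simp add: of_nat_eq_0_iff_char_dvd)
  ultimately show "coeff F i = 0" using assms(3) by simp
qed (rule that)

section \<open>Products of locators and the codeword condition\<close>

lemma prime_elem_dvd_prodD:
  fixes f :: "'i \<Rightarrow> 'a :: comm_semiring_1"
  assumes "finite A" "prime_elem p" "p dvd prod f A"
  shows "\<exists>i\<in>A. p dvd f i"
  using assms
  by (induction A) (auto simp: prime_elem_def dest: prime_elem_dvd_multD)

text \<open>A prime factor \<open>f j\<close> of a square divides it twice, so it would also divide
  the product of the remaining factors and hence one of them, against coprimality.\<close>

lemma prod_coprime_irreducible_not_square:
  fixes f :: "'i \<Rightarrow> 'a :: field poly"
  assumes "finite S" "S \<noteq> {}"
    and irr: "\<And>i. i \<in> S \<Longrightarrow> irreducible (f i)"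
    and cop: "\<And>i j. i \<in> S \<Longrightarrow> j \<in> S \<Longrightarrow> i \<noteq> j \<Longrightarrow> coprime (f i) (f j)"
  shows "prod f S \<noteq> K ^ 2"
proof
  assume eq: "prod f S = K ^ 2"
  obtain j where j: "j \<in> S" using assms(2) by blast
  have prime: "prime_elem (f j)" using irr[OF j] by (rule field_poly_irreducible_imp_prime)
  have F: "prod f S = f j * prod f (S - {j})" using assms(1) j by (rule prod.remove)
  then have "f j dvd K ^ 2" unfolding eq[symmetric] by simp
  then have "f j dvd K" using prime prime_elem_dvd_power by blast
  then have "f j ^ 2 dvd f j * prod f (S - {j})" unfolding F[symmetric] eq by (rule dvd_power_same)
  then have dvd: "f j dvd prod f (S - {j})"
    using prime by (auto simp: power2_eq_square)
  have "finite (S - {j})" using assms(1) by simp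
  from prime_elem_dvd_prodD[OF this prime dvd] obtain i where "i \<in> S - {j}" "f j dvd f i"
    by blast
  then have "is_unit (f j)" using cop[OF j, of i] coprime_common_divisor[of "f j" "f i" "f j"] by auto
  then show False using prime by (simp add: prime_elem_def)
qed

text \<open>The sum in the code condition is the logarithmic derivative of the support product
  modulo \<open>G\<close>. Multiplying by the product cancels each inverse and leaves the product
  rule.\<close>

lemma goppa_codeword_dvd_pderiv:
  fixes f :: "'n :: finite \<Rightarrow> 'a :: field poly"
  assumes "c \<in> generalized_goppa_code f G" "\<And>i. coprime (f i) G"
  shows "G dvd pderiv (\<Prod>i | c $ i \<noteq> 0. f i)"
proof -
  define S where "S = {i. c $ i \<noteq> 0}"
  let ?inv = "\<lambda>i. poly_inverse_mod G (f i)"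
  let ?F = "prod f S"
  have "(\<Sum>i\<in>UNIV. Polynomial.smult (of_bit (c $ i)) (pderiv (f i) * ?inv i)) =
      (\<Sum>i\<in>S. pderiv (f i) * ?inv i)"
    by (rule sum.mono_neutral_cong_right) (auto simp: S_def)
  then have "[?F * (\<Sum>i\<in>S. pderiv (f i) * ?inv i) = ?F * 0] (mod G)"
    using assms(1) by (intro cong_scalar_left) (simp add: generalized_goppa_code_def)
  moreover have "[?F * (\<Sum>i\<in>S. pderiv (f i) * ?inv i) = pderiv ?F] (mod G)"
    unfolding pderiv_prod sum_distrib_left
  proof (rule cong_sum)
    fix i assume "i \<in> S"
    then have "?F * (pderiv (f i) * ?inv i) =
        (prod f (S - {i}) * pderiv (f i)) * (f i * ?inv i)"
      by (subst prod.remove[of S i]) (simp_all add: algebra_simps)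
    moreover have "[(prod f (S - {i}) * pderiv (f i)) * (f i * ?inv i) =
        (prod f (S - {i}) * pderiv (f i)) * 1] (mod G)"
      by (intro cong_scalar_left poly_inverse_mod_cong assms(2))
    ultimately show "[?F * (pderiv (f i) * ?inv i) = prod f (S - {i}) * pderiv (f i)] (mod G)"
      by (simp only: mult_1_right)
  qed
  ultimately show ?thesis by (metis S_def cong_0_iff cong_sym cong_trans mult_zero_right)
qed

section \<open>Finite fields with \<open>2 ^ m\<close> elements\<close>

lemma finite_field_char_2:
  assumes "CARD('a :: finite_field) = 2 ^ m"
  shows "CHAR('a) = 2"
proof -
  have prime: "prime CHAR('a)" by (rule CHAR_prime)
  have "CHAR('a) dvd 2 ^ m" using CHAR_dvd_CARD[where 'a = 'a] unfolding assms .
  then have "CHAR('a) dvd 2" by (rule prime_dvd_power[OF prime])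
  then show ?thesis by (rule primes_dvd_imp_eq[OF prime two_is_prime_nat])
qed

lemma finite_field_square_surj:
  fixes x :: "'a :: finite_field"
  assumes "CARD('a) = 2 ^ m" "m > 0"
  shows "\<exists>y. y ^ 2 = x"
proof
  \<comment> \<open>The \<open>m\<close>-fold Frobenius map is the identity, so applying it
    \<open>m - 1\<close> times gives a square root.\<close>
  have "(x ^ 2 ^ (m - 1)) ^ 2 = x ^ 2 ^ m"
    using assms(2) by (simp only: power_mult[symmetric] power_Suc2[symmetric] Suc_diff_1)
  then show "(x ^ 2 ^ (m - 1)) ^ 2 = x"
    using finite_field_power_card_eq_same[of x] by (simp only: assms(1))
qed

section \<open>The degree bound and the minimum distance\<close>

lemma goppa_codeword_degree_bound:
  fixes f :: "'n :: finite \<Rightarrow> 'a :: field_prime_char poly"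
  assumes char: "CHAR('a) = 2" and perfect: "\<And>x :: 'a. \<exists>y. y ^ 2 = x"
    and G: "distinct_roots G"
    and irr: "\<And>i. irreducible (f i)"
    and even: "\<And>i. even (degree (f i))"
    and cop: "\<And>i j. i \<noteq> j \<Longrightarrow> coprime (f i) (f j)"
    and copG: "\<And>i. coprime (f i) G"
    and c: "c \<in> generalized_goppa_code f G" "c \<noteq> 0"
  shows "2 * degree G + 2 \<le> (\<Sum>i | c $ i \<noteq> 0. degree (f i))"
proof -
  let ?S = "{i. c $ i \<noteq> 0}"
  let ?F = "prod f ?S"
  have ne: "?S \<noteq> {}" using c(2) by (auto simp: vec_eq_iff)
  have deg: "degree ?F = (\<Sum>i\<in>?S. degree (f i))"
  proof (rule degree_prod_eq_sum_degree, intro ballI notI)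
    fix i assume "f i = 0"
    then show False using irr[of i] by (simp only: not_irreducible_zero)
  qed
  have evenF: "even (degree ?F)" unfolding deg using even by (intro dvd_sum) auto
  have nz: "pderiv ?F \<noteq> 0"
  proof
    assume "pderiv ?F = 0"
    then obtain K where "?F = K ^ 2"
      using pderiv_eq_0_imp_square_char_2[OF char perfect] by blast
    then show False using prod_coprime_irreducible_not_square[of ?S f K] ne irr cop by simp
  qed
  obtain H where H: "pderiv ?F = H ^ 2" using char perfect by (rule pderiv_is_square_char_2)
  have "G dvd H ^ 2" using goppa_codeword_dvd_pderiv[OF c(1) copG] H by simp
  then have "G dvd H" using squarefree_poly_dvd_square distinct_roots_imp_squarefree G by blast
  then have "degree G \<le> degree H" using H nz by (intro dvd_imp_degree_le) auto
  moreover have "degree (pderiv ?F) = 2 * degree H"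
  proof -
    have "H \<noteq> 0" using nz H by auto
    then show ?thesis unfolding H by (rule degree_power_eq)
  qed
  moreover have "degree (pderiv ?F) \<le> degree ?F - 1"
    by (rule degree_le) (auto simp: coeff_pderiv intro: coeff_eq_0)
  \<comment> \<open>This excludes truncation in \<open>degree ?F - 1\<close>. An even number at most
    \<open>degree ?F - 1\<close>, with \<open>degree ?F\<close> even and positive, is at most
    \<open>degree ?F - 2\<close>.\<close>
  moreover have "degree ?F \<noteq> 0"
    using nz by (metis degree_eq_zeroE pderiv_singleton)
  ultimately show ?thesis using evenF unfolding deg by presburger
qed

theorem corollary2:
  fixes m n r l :: nat
    and G :: "'a :: finite_field poly"
    and f :: "'n :: finite \<Rightarrow> 'a poly"
  assumes "m > 0" and "n > 0" and "r > 0" and "r * m \<le> n"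
    and "CARD('a) = 2 ^ m"
    and "CARD('n) = n"
    and "Polynomial.degree G = r"
    and "distinct_roots G"
    and "\<And>i. Factorial_Ring.irreducible (f i)"
    and "\<And>i. even (Polynomial.degree (f i))"
    and "\<And>i j. i \<noteq> j \<Longrightarrow> coprime (f i) (f j)"
    and "\<And>i. coprime (f i) G"
    and "l = Max (Polynomial.degree ` range f)"
  shows "ereal ((2 * real r + 2) / real l)
           \<le> ereal_of_enat (minimum_distance (generalized_goppa_code f G))"
proof (cases "generalized_goppa_code f G - {0} = {}")
  case True
  then have "minimum_distance (generalized_goppa_code f G) = \<infinity>"
    unfolding minimum_distance_def by (simp only: image_empty Inf_empty top_enat_def)
  then show ?thesis by simp
next
  case False
  let ?C = "generalized_goppa_code f G"
  \<comment> \<open>The order on \<open>enat\<close> is a well-order, so the infimum of a nonempty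
    set is attained, and one codeword of minimum weight suffices.\<close>
  have "minimum_distance ?C \<in> (\<lambda>c. enat (hamming_weight c)) ` (?C - {0})"
  proof -
    obtain c0 where "c0 \<in> ?C - {0}" using False by blast
    then have "enat (hamming_weight c0) \<in> (\<lambda>c. enat (hamming_weight c)) ` (?C - {0})"
      by (rule imageI)
    then show ?thesis unfolding minimum_distance_def by (rule wellorder_InfI)
  qed
  then obtain c where c: "c \<in> ?C" "c \<noteq> 0" "minimum_distance ?C = enat (hamming_weight c)"
    by blast
  have "2 * r + 2 \<le> (\<Sum>i | c $ i \<noteq> 0. Polynomial.degree (f i))"
    unfolding \<open>Polynomial.degree G = r\<close>[symmetric]
    by (rule goppa_codeword_degree_bound[OF finite_field_char_2[OF assms(5)]
          finite_field_square_surj[OF assms(5,1)] assms(8-12) c(1,2)])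
  also have "\<dots> \<le> hamming_weight c * l"
  proof -
    have "Polynomial.degree (f i) \<le> l" for i
      unfolding assms(13) by (rule Max_ge) auto
    then show ?thesis
      using sum_bounded_above[of "{i. c $ i \<noteq> 0}" "\<lambda>i. Polynomial.degree (f i)" l]
      by (simp only: hamming_weight_def of_nat_id)
  qed
  finally have le: "2 * r + 2 \<le> hamming_weight c * l" .
  \<comment> \<open>For \<open>l = 0\<close> the bound would read \<open>2 * r + 2 \<le> 0\<close>;
    positivity permits the division by \<open>l\<close>.\<close>
  then have "l > 0" by (cases l) auto
  from le have "real (2 * r + 2) \<le> real (hamming_weight c * l)" by (simp only: of_nat_le_iff)
  then have "(2 * real r + 2) / real l \<le> real (hamming_weight c)"
    using \<open>l > 0\<close> by (simp add: divide_le_eq)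
  then show ?thesis using c(3) by simp
qed

end
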